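(* Let $d>0$, let $I=[a,b]$ with $\ell(I)=b-a\ge 2d$, and let $f:I\to\mathbb{R}$ be a function of $d$-bounded variation. Then for every $c\in[a+d,b-d]$, $$V_{d,[a,c]}(f)+V_{d,[c,b]}(f)\le V_{d,[a,b]}(f).$$
   Context: For an interval $[s,t]$ with $t-s\ge d$, put $V_{d,[s,t]}(f)=\sup_P\sum_{i=1}^n|f(x_i)-f(x_{i-1})|$, the supremum being over all partitions $P=\{s=x_0<\cdots<x_n=t\}$ with $x_i-x_{i-1}\ge d$ for all $i\in\{1,\dots,n\}$ (total $d$-variation). $f$ is of $d$-bounded variation on $I$ if $V_{d,[a,b]}(f)<\infty$. *)

theory Defs
  imports "HOL-Analysis.Analysis"
begin

text \<open>The finite sequence \<open>x 0, \<dots>, x n\<close> is encoded by a function on all of \<open>nat\<close>;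
  its values beyond \<open>n\<close> are irrelevant.\<close>

definition d_partition :: "real \<Rightarrow> real \<Rightarrow> real \<Rightarrow> nat \<Rightarrow> (nat \<Rightarrow> real) \<Rightarrow> bool" where
  "d_partition d s t n x \<longleftrightarrow>
     x 0 = s \<and> x n = t \<and>
     (\<forall>i\<in>{1..n}. x (i - 1) < x i) \<and>
     (\<forall>i\<in>{1..n}. d \<le> x i - x (i - 1))"

text \<open>The supremum is taken in the extended reals. For \<open>0 < d \<le> t - s\<close> it ranges over a nonempty
  set, since \<open>s, t\<close> itself is then an admissible partition, and it depends only on the values
  of \<open>f\<close> on \<open>{s..t}\<close>.\<close>

definition d_variation :: "real \<Rightarrow> real \<Rightarrow> real \<Rightarrow> (real \<Rightarrow> real) \<Rightarrow> ereal" where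
  "d_variation d s t f =
     (SUP (n, x) \<in> {(n, x). d_partition d s t n x}.
        ereal (\<Sum>i = 1..n. \<bar>f (x i) - f (x (i - 1))\<bar>))"

definition d_bounded_variation :: "real \<Rightarrow> real \<Rightarrow> real \<Rightarrow> (real \<Rightarrow> real) \<Rightarrow> bool" where
  "d_bounded_variation d a b f \<longleftrightarrow> d_variation d a b f < \<infinity>"

end

theory Submission
  imports Defs
begin

text \<open>An admissible partition of [a,c] followed by one of [c,b] is an admissible partition of
  [a,b]: the two share the point c, so no step straddles it and every step keeps length at least d
  (\<open>d_partition_concat\<close>). The variation sum of the joined partition is the sum of the
  two separate ones (\<open>sum_concat\<close>), hence every such pair of sums adds up to at most
  \<open>d_variation d a b f\<close>. Taking the supremum over the second partition with the first
  fixed, and then over the first, gives the claim. In \<open>ereal\<close> a summand moves out of a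
  supremum if the index set is nonempty and the summand is not -\<infinity>; both rest on the
  two-point partition (\<open>d_partition_endpoints\<close>,
  \<open>d_variation_nonneg\<close>).\<close>

lemma sum_le_d_variation:
  assumes "d_partition d s t n x"
  shows "ereal (\<Sum>i = 1..n. \<bar>f (x i) - f (x (i - 1))\<bar>) \<le> d_variation d s t f"
  unfolding d_variation_def using assms by (intro SUP_upper2[where i = "(n, x)"]) auto

lemma d_partition_endpoints:
  assumes "d > 0" "d \<le> t - s"
  shows "d_partition d s t 1 (\<lambda>i. if i = 0 then s else t)"
  using assms by (auto simp: d_partition_def)

text \<open>Excludes the value -\<infinity>, which a supremum over an empty set of partitions would
  have.\<close>

lemma d_variation_nonneg:
  assumes "d > 0" "d \<le> t - s"
  shows "0 \<le> d_variation d s t f"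
proof -
  have "0 \<le> ereal \<bar>f t - f s\<bar>" by simp
  also have "\<dots> \<le> d_variation d s t f"
    using sum_le_d_variation[OF d_partition_endpoints[OF assms], of f] by simp
  finally show ?thesis .
qed

lemma d_partition_concat:
  assumes x: "d_partition d s t n x" and y: "d_partition d t u m y"
  shows "d_partition d s u (n + m) (\<lambda>i. if i \<le> n then x i else y (i - n))"
proof -
  let ?z = "\<lambda>i. if i \<le> n then x i else y (i - n)"
  have join: "x n = y 0" using x y by (simp add: d_partition_def)
  have "?z (i - 1) < ?z i \<and> d \<le> ?z i - ?z (i - 1)" if i: "i \<in> {1..n + m}" for i
  proof (cases "i \<le> n")
    case True
    then show ?thesis using x i by (auto simp: d_partition_def)
  next
    case False
    then have "i - n \<in> {1..m}" using i by auto
    then have "y (i - n - 1) < y (i - n) \<and> d \<le> y (i - n) - y (i - n - 1)"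
      using y unfolding d_partition_def by blast
    \<comment> \<open>For \<open>i = Suc n\<close> the predecessor index still falls in the
      \<open>x\<close> branch, and \<open>join\<close> identifies \<open>x n\<close> with
      \<open>y 0\<close>.\<close>
    moreover have "?z (i - 1) = y (i - n - 1)"
      using False join by (cases "i = Suc n") (auto simp: diff_commute)
    moreover have "?z i = y (i - n)" using False by simp
    ultimately show ?thesis by (simp only:)
  qed
  moreover have "?z (n + m) = u"
    \<comment> \<open>If \<open>m = 0\<close>, the last index lies in the \<open>x\<close> branch;
      then \<open>t = y 0 = u\<close>.\<close>
    using x y by (cases "m = 0") (auto simp: d_partition_def)
  ultimately show ?thesis using x by (auto simp: d_partition_def)
qed

text \<open>Split the sum after index \<open>n\<close> and shift the tail by \<open>n\<close>; the
  first tail term is the first term for \<open>y\<close> because the sequences meet at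
  \<open>x n = y 0\<close>.\<close>

lemma sum_concat:
  fixes f :: "real \<Rightarrow> real" and x y :: "nat \<Rightarrow> real"
  assumes join: "x n = y 0"
  defines "z \<equiv> \<lambda>i. if i \<le> n then x i else y (i - n)"
  shows "(\<Sum>i = 1..n + m. \<bar>f (z i) - f (z (i - 1))\<bar>) =
    (\<Sum>i = 1..n. \<bar>f (x i) - f (x (i - 1))\<bar>) + (\<Sum>i = 1..m. \<bar>f (y i) - f (y (i - 1))\<bar>)"
proof -
  have "(\<Sum>i = 1 + n..m + n. \<bar>f (z i) - f (z (i - 1))\<bar>) =
      (\<Sum>i = 1..m. \<bar>f (z (i + n)) - f (z (i + n - 1))\<bar>)"
    using sum.shift_bounds_cl_nat_ivl[of "\<lambda>i. \<bar>f (z i) - f (z (i - 1))\<bar>" 1 n m] .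
  also have "\<dots> = (\<Sum>i = 1..m. \<bar>f (y i) - f (y (i - 1))\<bar>)"
  proof (rule sum.cong[OF refl])
    fix i assume "i \<in> {1..m}"
    then obtain k where "i = Suc k" by (cases i) auto
    then have "z (i + n) = y i" by (simp add: z_def)
    moreover have "z (i + n - 1) = y (i - 1)"
      using \<open>i = Suc k\<close> join by (cases "k = 0") (simp_all add: z_def)
    ultimately show "\<bar>f (z (i + n)) - f (z (i + n - 1))\<bar> = \<bar>f (y i) - f (y (i - 1))\<bar>" by simp
  qed
  finally have "(\<Sum>i = n + 1..n + m. \<bar>f (z i) - f (z (i - 1))\<bar>) =
      (\<Sum>i = 1..m. \<bar>f (y i) - f (y (i - 1))\<bar>)"
    unfolding add.commute[of 1 n] add.commute[of m n] .
  moreover have "(\<Sum>i = 1..n. \<bar>f (z i) - f (z (i - 1))\<bar>) =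
      (\<Sum>i = 1..n. \<bar>f (x i) - f (x (i - 1))\<bar>)"
    by (rule sum.cong) (auto simp: z_def)
  moreover have "(\<Sum>i = 1..n + m. \<bar>f (z i) - f (z (i - 1))\<bar>) =
      (\<Sum>i = 1..n. \<bar>f (z i) - f (z (i - 1))\<bar>) + (\<Sum>i = n + 1..n + m. \<bar>f (z i) - f (z (i - 1))\<bar>)"
    by (rule sum.ub_add_nat) simp
  ultimately show ?thesis by (simp only:)
qed

theorem proposition4p2:
  fixes a b c d :: real and f :: "real \<Rightarrow> real"
  assumes "d > 0"
    and "b - a \<ge> 2 * d"
    and "d_bounded_variation d a b f"
    and "c \<in> {a + d..b - d}"
  shows "d_variation d a c f + d_variation d c b f \<le> d_variation d a b f"
proof -
  let ?P = "\<lambda>s t. {(n, x). d_partition d s t n x}"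
  let ?S = "\<lambda>(n, x). ereal (\<Sum>i = 1..n. \<bar>f (x i) - f (x (i - 1))\<bar>)"
  have V: "d_variation d s t f = (SUP p \<in> ?P s t. ?S p)" for s t
    by (simp add: d_variation_def)
  have ac: "d \<le> c - a" and cb: "d \<le> b - c" using assms by auto
  \<comment> \<open>The range of \<open>c\<close> leaves both halves at least d long, so each has
    its two-point partition.\<close>
  have ne: "?P a c \<noteq> {}" "?P c b \<noteq> {}"
    using d_partition_endpoints[OF \<open>d > 0\<close> ac] d_partition_endpoints[OF \<open>d > 0\<close> cb] by blast+
  have concat: "?S p + ?S q \<le> d_variation d a b f" if p: "p \<in> ?P a c" and q: "q \<in> ?P c b" for p q
  proof -
    obtain n x m y where pq: "p = (n, x)" "q = (m, y)" by fastforce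
    then have x: "d_partition d a c n x" and y: "d_partition d c b m y" using p q by auto
    then have "x n = y 0" by (simp add: d_partition_def)
    from sum_le_d_variation[OF d_partition_concat[OF x y], of f] show ?thesis
      unfolding pq
        sum_concat[where x = x and y = y and n = n, OF \<open>x n = y 0\<close>] by simp
  qed
  have "?S p + d_variation d c b f \<le> d_variation d a b f" if p: "p \<in> ?P a c" for p
  proof -
    \<comment> \<open>The fixed summand \<open>?S p\<close> is a real number, so it passes through
      the supremum over \<open>q\<close>.\<close>
    have "?S p + d_variation d c b f = (SUP q \<in> ?P c b. ?S p + ?S q)"
      unfolding V by (rule SUP_ereal_add_right[symmetric]) (use ne in \<open>auto split: prod.split\<close>)
    also have "\<dots> \<le> d_variation d a b f" by (intro SUP_least concat p)
    finally show ?thesis .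
  qed
  then have "(SUP p \<in> ?P a c. ?S p + d_variation d c b f) \<le> d_variation d a b f"
    by (rule SUP_least)
  \<comment> \<open>Now the fixed summand is itself a supremum; its nonnegativity is what keeps it
    away from -\<infinity>.\<close>
  moreover have "(SUP p \<in> ?P a c. ?S p + d_variation d c b f)
      = d_variation d a c f + d_variation d c b f"
    unfolding V[of a c] using ne d_variation_nonneg[OF \<open>d > 0\<close> cb, of f]
    by (intro SUP_ereal_add_left) auto
  ultimately show ?thesis by simp
qed

end
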